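(* $\mathsf{non}(\mathsf{S}_1(\mathcal{B}_\mathrm{T},\mathcal{B}_\Gamma))=\mathsf{non}(\mathsf{S}_1(\mathrm{T},\Gamma))=\mathfrak{t}$.
   Context: All spaces $X$ are infinite sets of reals; all covers considered are assumed not to contain $X$ as a member. A cover is a $\gamma$-cover of $X$ if it is infinite and each point lies in all but finitely many members; large if each point lies in infinitely many members. A large cover $\mathcal{U}$ is a $\tau$-cover if for all $x,y\in X$, either ($x\in U\Rightarrow y\in U$) for all but finitely many $U\in\mathcal{U}$, or ($y\in U\Rightarrow x\in U$) for all but finitely many $U\in\mathcal{U}$. $\Gamma,\mathrm{T}$ are the collections of countable open $\gamma$-, $\tau$-covers; $\mathcal{B}_\Gamma,\mathcal{B}_\mathrm{T}$ their countable Borel analogues. $X$ satisfies $\mathsf{S}_1(\mathfrak{U},\mathfrak{V})$ if for every sequence $(\mathcal{U}_n)$ of members of $\mathfrak{U}$ there are $U_n\in\mathcal{U}_n$ with $\{U_n:n\in\mathbb{N}\}\in\mathfrak{V}$. For a class $\mathcal{J}$ of sets of reals, $\mathsf{non}(\mathcal{J})$ is the minimal cardinality of a set of reals not in $\mathcal{J}$. $\mathfrak{t}$ is the minimal size of a tower: a family of infinite subsets of $\mathbb{N}$ linearly quasiordered by $\subseteq^*$ ($a\subseteq^*b$ iff $a\setminus b$ finite) with no infinite $a\subseteq\mathbb{N}$ such that $a\subseteq^* b$ for all its members $b$. *)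

theory Defs
  imports "HOL-Analysis.Analysis"
begin

unbundle cardinal_syntax

text \<open>
  A cover of the space \<open>X\<close> consists of subsets of \<open>X\<close>; ``open'' and ``Borel'' refer to the
  subspace structure.  As usual in this context, \<open>X\<close> itself is not allowed as a member.
\<close>

definition is_cover :: "'a set \<Rightarrow> 'a set set \<Rightarrow> bool" where
  "is_cover X \<U> \<longleftrightarrow> \<Union>\<U> = X \<and> X \<notin> \<U>"

definition large_cover :: "'a set \<Rightarrow> 'a set set \<Rightarrow> bool" where
  "large_cover X \<U> \<longleftrightarrow> is_cover X \<U> \<and> (\<forall>x\<in>X. infinite {U \<in> \<U>. x \<in> U})"

definition gamma_cover :: "'a set \<Rightarrow> 'a set set \<Rightarrow> bool" where
  "gamma_cover X \<U> \<longleftrightarrow> is_cover X \<U> \<and> infinite \<U> \<and> (\<forall>x\<in>X. finite {U \<in> \<U>. x \<notin> U})"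

definition tau_cover :: "'a set \<Rightarrow> 'a set set \<Rightarrow> bool" where
  "tau_cover X \<U> \<longleftrightarrow> large_cover X \<U> \<and>
     (\<forall>x\<in>X. \<forall>y\<in>X. finite {U \<in> \<U>. \<not> (x \<in> U \<longrightarrow> y \<in> U)} \<or> finite {U \<in> \<U>. \<not> (y \<in> U \<longrightarrow> x \<in> U)})"

definition open_gamma_covers :: "real set \<Rightarrow> real set set set" where
  "open_gamma_covers X = {\<U>. gamma_cover X \<U> \<and> countable \<U> \<and> (\<forall>U\<in>\<U>. openin (top_of_set X) U)}"

definition open_tau_covers :: "real set \<Rightarrow> real set set set" where
  "open_tau_covers X = {\<U>. tau_cover X \<U> \<and> countable \<U> \<and> (\<forall>U\<in>\<U>. openin (top_of_set X) U)}"

definition borel_gamma_covers :: "real set \<Rightarrow> real set set set" where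
  "borel_gamma_covers X = {\<U>. gamma_cover X \<U> \<and> countable \<U> \<and> (\<forall>U\<in>\<U>. U \<in> sets (restrict_space borel X))}"

definition borel_tau_covers :: "real set \<Rightarrow> real set set set" where
  "borel_tau_covers X = {\<U>. tau_cover X \<U> \<and> countable \<U> \<and> (\<forall>U\<in>\<U>. U \<in> sets (restrict_space borel X))}"

text \<open>
  The collections of covers depend on the space, so they are passed as functions of \<open>X\<close>;
  the result is the class of all \<open>X\<close> satisfying the selection principle.
\<close>

definition S1 :: "('a set \<Rightarrow> 'a set set set) \<Rightarrow> ('a set \<Rightarrow> 'a set set set) \<Rightarrow> 'a set set" where
  "S1 \<AA> \<BB> = {X. \<forall>\<U> :: nat \<Rightarrow> 'a set set. (\<forall>n. \<U> n \<in> \<AA> X) \<longrightarrow>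
     (\<exists>U. (\<forall>n. U n \<in> \<U> n) \<and> range U \<in> \<BB> X)}"

text \<open>
  The least cardinality of a member of \<open>\<F>\<close>, as an (HOL) cardinal; it is determined up to \<open>=o\<close>.
  For empty \<open>\<F>\<close> the value is the empty order, i.e. the cardinal 0, so that such a junk value
  cannot be confused with the least cardinality of a nonempty family of infinite sets.
\<close>

definition min_card :: "'a set set \<Rightarrow> 'a rel" where
  "min_card \<F> = (if \<F> = {} then {} else |SOME A. A \<in> \<F> \<and> (\<forall>B\<in>\<F>. |A| \<le>o |B| )| )"

lemma min_card_attained:
  assumes "\<F> \<noteq> {}"
  shows "\<exists>A\<in>\<F>. min_card \<F> = |A| \<and> (\<forall>B\<in>\<F>. |A| \<le>o |B| )"
proof -
  have "\<exists>r\<in>card_of ` \<F>. \<forall>r'\<in>card_of ` \<F>. r \<le>o r'"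
    using assms by (intro exists_minim_Well_order) (auto simp: card_of_Well_order)
  then have "\<exists>A. A \<in> \<F> \<and> (\<forall>B\<in>\<F>. |A| \<le>o |B| )" by auto
  from someI_ex[OF this] show ?thesis
    using assms by (auto simp: min_card_def)
qed

text \<open>All spaces are infinite sets of reals.\<close>

definition non :: "real set set \<Rightarrow> real rel" where
  "non \<J> = min_card {X. infinite X \<and> X \<notin> \<J>}"

definition almost_subset :: "nat set \<Rightarrow> nat set \<Rightarrow> bool" (infix "\<subseteq>*" 50) where
  "a \<subseteq>* b \<longleftrightarrow> finite (a - b)"

definition tower :: "nat set set \<Rightarrow> bool" where
  "tower T \<longleftrightarrow> (\<forall>a\<in>T. infinite a) \<and> (\<forall>a\<in>T. \<forall>b\<in>T. a \<subseteq>* b \<or> b \<subseteq>* a) \<and>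
     \<not> (\<exists>a. infinite a \<and> (\<forall>b\<in>T. a \<subseteq>* b))"

definition tower_number :: "nat set rel" where
  "tower_number = min_card {T. tower T}"

lemma tower_exists: "\<exists>T. tower T"
proof -
  define \<C> where "\<C> = {T. (\<forall>a\<in>T. infinite a) \<and> (\<forall>a\<in>T. \<forall>b\<in>T. a \<subseteq>* b \<or> b \<subseteq>* a)}"
  have "\<exists>M\<in>\<C>. \<forall>T\<in>\<C>. M \<subseteq> T \<longrightarrow> T = M"
  proof (rule subset_Zorn')
    fix K assume K: "subset.chain \<C> K"
    have "a \<subseteq>* b \<or> b \<subseteq>* a" if ab: "a \<in> A" "b \<in> B" "A \<in> K" "B \<in> K" for a b A B
    proof -
      have "A \<in> \<C>" "B \<in> \<C>" "A \<subseteq> B \<or> B \<subseteq> A"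
        using K ab by (auto simp: subset_chain_def)
      then show ?thesis using ab unfolding \<C>_def by blast
    qed
    moreover have "\<forall>A\<in>K. \<forall>a\<in>A. infinite a"
      using K unfolding subset_chain_def \<C>_def by blast
    ultimately show "\<Union>K \<in> \<C>" unfolding \<C>_def by blast
  qed
  then obtain M where M: "M \<in> \<C>" "\<And>T. T \<in> \<C> \<Longrightarrow> M \<subseteq> T \<Longrightarrow> T = M" by blast
  have False if a: "infinite a" "\<forall>b\<in>M. a \<subseteq>* b" for a
  proof -
    define b where "b = range (\<lambda>n. enumerate a (2 * n))"
    define c where "c = range (\<lambda>n. enumerate a (2 * n + 1))"
    have inj: "inj (enumerate a)"
      using a(1) by (simp add: strict_mono_enumerate strict_mono_imp_inj_on)
    have infb: "infinite b" and infc: "infinite c"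
      unfolding b_def c_def by (rule range_inj_infinite, rule injI, drule injD[OF inj], simp)+
    have ba: "b \<subseteq> a" using a(1) by (auto simp: b_def enumerate_in_set)
    have "enumerate a (2 * m + 1) \<noteq> enumerate a (2 * n)" for m n
      by (auto dest!: injD[OF inj]) presburger
    then have "c \<subseteq> a - b"
      using a(1) by (auto simp: b_def c_def enumerate_in_set)
    then have "\<not> a \<subseteq>* b" unfolding almost_subset_def using infc finite_subset by blast
    then have "b \<notin> M" using a(2) by blast
    have "b \<subseteq>* d" if "d \<in> M" for d
      using a(2) that ba finite_subset[of "b - d" "a - d"] unfolding almost_subset_def by blast
    moreover have "b \<subseteq>* b" by (simp add: almost_subset_def)
    ultimately have "insert b M \<in> \<C>" using M(1) infb unfolding \<C>_def by auto
    then show False using M(2) \<open>b \<notin> M\<close> by blast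
  qed
  then have "tower M" using M(1) unfolding tower_def \<C>_def by blast
  then show ?thesis ..
qed

end

theory Submission
  imports Defs
begin

text \<open>
  Fewer than \<open>\<tt>\<close> points: viewing a countable \<open>\<tau>\<close>-cover as a sequence, the index sets
  \<open>{n. x \<in> U\<^sub>n}\<close> are linearly quasiordered by \<open>\<subseteq>*\<close>, so a pseudo-intersection of them gives a
  \<open>\<gamma>\<close>-subcover.  Picking one member from each of countably many \<open>\<gamma>\<close>-covers then amounts to
  bounding fewer than \<open>\<tt>\<close> functions in the order of eventual domination.

  Conversely, a tower enlarged by the sets \<open>-{n}\<close> and embedded in the reals as a subset
  of a Cantor set, has the clopen \<open>\<tau>\<close>-cover \<open>{a. n \<in> a}\<close>, \<open>n \<in> \<nat>\<close>, and the indices of a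
  \<open>\<gamma>\<close>-subcover would form a pseudo-intersection of the tower.
\<close>

subsection \<open>Families smaller than the tower number\<close>

lemma almost_subset_trans: "a \<subseteq>* b \<Longrightarrow> b \<subseteq>* c \<Longrightarrow> a \<subseteq>* c"
  unfolding almost_subset_def by (rule finite_subset[of _ "(a - b) \<union> (b - c)"]) auto

lemma subset_imp_almost_subset: "a \<subseteq> b \<Longrightarrow> a \<subseteq>* b"
  unfolding almost_subset_def by (metis Diff_eq_empty_iff finite.emptyI)

lemma tower_number_attained:
  obtains T where "tower T" "tower_number = |T|" "\<And>S. tower S \<Longrightarrow> |T| \<le>o |S|"
  using min_card_attained[of "{T. tower T}"] tower_exists unfolding tower_number_def by auto

lemma pseudo_intersection_exists:
  assumes "|I| <o tower_number"
    and inf: "\<And>i. i \<in> I \<Longrightarrow> infinite (a i)"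
    and lin: "\<And>i j. i \<in> I \<Longrightarrow> j \<in> I \<Longrightarrow> a i \<subseteq>* a j \<or> a j \<subseteq>* a i"
  obtains c where "infinite c" "\<And>i. i \<in> I \<Longrightarrow> c \<subseteq>* a i"
proof -
  obtain T where T: "tower_number = |T|" "\<And>S. tower S \<Longrightarrow> |T| \<le>o |S|"
    using tower_number_attained by metis
  have "|a ` I| <o |T|"
    using card_of_image[of a I] assms(1) T(1) ordLeq_ordLess_trans by metis
  then have "\<not> tower (a ` I)"
    using T(2) not_ordLess_ordLeq by blast
  moreover have "\<forall>b\<in>a ` I. infinite b" "\<forall>b\<in>a ` I. \<forall>c\<in>a ` I. b \<subseteq>* c \<or> c \<subseteq>* b"
    using inf lin by simp_all
  ultimately obtain c where "infinite c" "\<forall>b\<in>a ` I. c \<subseteq>* b"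
    unfolding tower_def by blast
  then show thesis
    by (intro that) blast+
qed

text \<open>
  A transfinite construction of a decreasing sequence meeting all the \<open>D i\<close>, carried out with
  Zorn's lemma on partial choice functions with linearly quasiordered range.
\<close>

lemma pseudo_intersection_dense:
  fixes I :: "'i set" and D :: "'i \<Rightarrow> nat set set"
  assumes I: "|I| <o tower_number"
    and inf: "\<And>i d. i \<in> I \<Longrightarrow> d \<in> D i \<Longrightarrow> infinite d"
    and dense: "\<And>i a. i \<in> I \<Longrightarrow> infinite a \<Longrightarrow> \<exists>d\<in>D i. d \<subseteq> a"
  obtains c where "infinite c" "\<And>i. i \<in> I \<Longrightarrow> \<exists>d\<in>D i. c \<subseteq>* d"
proof -
  define \<C> where "\<C> = {P. P \<subseteq> (SIGMA i:I. D i) \<and> single_valued P \<and>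
      (\<forall>p\<in>P. \<forall>q\<in>P. snd p \<subseteq>* snd q \<or> snd q \<subseteq>* snd p)}"
  have "\<exists>M\<in>\<C>. \<forall>P\<in>\<C>. M \<subseteq> P \<longrightarrow> P = M"
  proof (rule subset_Zorn')
    fix K assume K: "subset.chain \<C> K"
    have common: "\<exists>R\<in>K. p \<in> R \<and> q \<in> R" if "p \<in> \<Union>K" "q \<in> \<Union>K" for p q
      using K that unfolding subset_chain_def by blast
    have KC: "\<And>R. R \<in> K \<Longrightarrow> R \<in> \<C>"
      using K unfolding subset_chain_def by blast
    have "\<Union>K \<subseteq> (SIGMA i:I. D i)"
      using KC unfolding \<C>_def by blast
    moreover have "single_valued (\<Union>K)"
    proof (rule single_valuedI)
      fix x y z assume "(x, y) \<in> \<Union>K" "(x, z) \<in> \<Union>K"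
      from common[OF this] KC show "y = z"
        unfolding \<C>_def by (auto dest: single_valuedD)
    qed
    moreover have "snd p \<subseteq>* snd q \<or> snd q \<subseteq>* snd p" if "p \<in> \<Union>K" "q \<in> \<Union>K" for p q
      using common[OF that] KC unfolding \<C>_def by blast
    ultimately show "\<Union>K \<in> \<C>"
      unfolding \<C>_def by blast
  qed
  then obtain M where M: "M \<in> \<C>" "\<And>P. P \<in> \<C> \<Longrightarrow> M \<subseteq> P \<Longrightarrow> P = M"
    by blast
  have sub: "M \<subseteq> (SIGMA i:I. D i)" and sv: "single_valued M"
    and lin: "\<And>p q. p \<in> M \<Longrightarrow> q \<in> M \<Longrightarrow> snd p \<subseteq>* snd q \<or> snd q \<subseteq>* snd p"
    using M(1) unfolding \<C>_def by auto
  \<comment> \<open>\<open>M\<close> is the graph of a partial function on \<open>I\<close>, so its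
    values are few enough to have a pseudo-intersection.\<close>
  have "inj_on fst M"
    using sv unfolding inj_on_def single_valued_def by (metis prod.collapse)
  moreover have "fst ` M \<subseteq> I"
    using sub by auto
  ultimately have "|M| \<le>o |I|"
    using card_of_ordLeq by blast
  then have "|M| <o tower_number"
    using I ordLeq_ordLess_trans by blast
  moreover have "infinite (snd p)" if "p \<in> M" for p
    using sub that inf by auto
  ultimately obtain c where c: "infinite c" "\<And>p. p \<in> M \<Longrightarrow> c \<subseteq>* snd p"
    using lin pseudo_intersection_exists[of M snd] by blast
  have "\<exists>d\<in>D i. c \<subseteq>* d" if i: "i \<in> I" for i
  proof (cases "i \<in> fst ` M")
    case True
    then obtain d where "(i, d) \<in> M"
      by auto
    then show ?thesis using c(2)[of "(i, d)"] sub by auto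
  next
    case False
    \<comment> \<open>Were the maximal \<open>M\<close> undefined at \<open>i\<close>, density would
      give a member of \<open>D i\<close> inside \<open>c\<close>, hence almost inside every value
      of \<open>M\<close>. Adding it would extend \<open>M\<close>, a contradiction.\<close>
    obtain d where d: "d \<in> D i" "d \<subseteq> c"
      using dense[OF i c(1)] by blast
    have dM: "d \<subseteq>* snd p" if "p \<in> M" for p
      using almost_subset_trans[OF subset_imp_almost_subset[OF d(2)] c(2)[OF that]] .
    have "single_valued (insert (i, d) M)"
      using sv False unfolding single_valued_def by (auto simp: image_iff)
    moreover have "insert (i, d) M \<subseteq> (SIGMA i:I. D i)"
      using sub i d by auto
    moreover have "\<forall>p\<in>insert (i, d) M. \<forall>q\<in>insert (i, d) M. snd p \<subseteq>* snd q \<or> snd q \<subseteq>* snd p"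
      by (simp add: lin dM subset_imp_almost_subset)
    ultimately have "insert (i, d) M \<in> \<C>"
      unfolding \<C>_def by blast
    then have "insert (i, d) M = M"
      using M(2) by blast
    then have "(i, d) \<in> M"
      by blast
    then show ?thesis
      using False by force
  qed
  then show thesis by (rule that[OF c(1)])
qed

section \<open>Bounding functions in the order of eventual domination\<close>

lemma infinite_sparse_subset:
  fixes a :: "nat set" and F :: "nat \<Rightarrow> nat"
  assumes "infinite a"
  obtains d where "infinite d" "d \<subseteq> a" "\<And>m k j. m \<in> d \<Longrightarrow> k \<in> d \<Longrightarrow> m < k \<Longrightarrow> j \<le> m \<Longrightarrow> F j \<le> k"
proof -
  have ex: "\<exists>k\<in>a. n < k" for n
    using assms infinite_nat_iff_unbounded by blast
  have "\<exists>s. \<forall>n. s n \<in> a \<and> (s n < s (Suc n) \<and> (\<forall>j\<le>s n. F j \<le> s (Suc n)))"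
  proof (rule dependent_nat_choice)
    show "\<exists>x. x \<in> a" using ex by blast
  next
    fix x n
    \<comment> \<open>The sum bounds all \<open>F j\<close> with \<open>j \<le> x\<close> at once,
      and the summand \<open>x\<close> makes the sequence strictly increasing.\<close>
    obtain k where "k \<in> a" "x + (\<Sum>j\<le>x. F j) < k"
      using ex by blast
    moreover have "F j \<le> (\<Sum>j\<le>x. F j)" if "j \<le> x" for j
      using that by (intro member_le_sum) auto
    ultimately show "\<exists>y. y \<in> a \<and> (x < y \<and> (\<forall>j\<le>x. F j \<le> y))"
      by (intro exI[of _ k]) (force intro: order_trans)
  qed
  then obtain s where s: "\<And>n. s n \<in> a" "\<And>n. s n < s (Suc n)"
      "\<And>n j. j \<le> s n \<Longrightarrow> F j \<le> s (Suc n)"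
    by blast
  have mono: "strict_mono s"
    using s(2) by (simp add: strict_mono_Suc_iff)
  show thesis
  proof
    show "infinite (range s)"
      using mono by (intro range_inj_infinite strict_mono_imp_inj_on)
    show "range s \<subseteq> a"
      using s(1) by blast
    fix m k j assume "m \<in> range s" "k \<in> range s" "m < k" "j \<le> m"
    then obtain p q where pq: "m = s p" "k = s q" "p < q"
      using mono strict_mono_less by blast
    have "F j \<le> s (Suc p)"
      using s(3) \<open>j \<le> m\<close> pq by blast
    also have "\<dots> \<le> s q"
      using mono pq(3) by (simp add: strict_mono_less_eq)
    finally show "F j \<le> k" using pq by simp
  qed
qed

text \<open>This is the inequality between the tower number and the bounding number. The sets that
  grow fast enough for \<open>f i\<close> are dense below every infinite set, so one infinite
  \<open>c\<close> is almost contained in such a set for each \<open>i\<close>, and the gaps of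
  \<open>c\<close> yield the bound.\<close>

lemma eventually_bounded_below_tower_number:
  fixes f :: "'i \<Rightarrow> nat \<Rightarrow> nat"
  assumes "|I| <o tower_number"
  obtains g where "\<And>i. i \<in> I \<Longrightarrow> \<exists>N. \<forall>n\<ge>N. f i n \<le> g n"
proof -
  define D where "D i = {d. infinite d \<and> (\<forall>m\<in>d. \<forall>k\<in>d. \<forall>j. m < k \<longrightarrow> j \<le> m \<longrightarrow> f i j \<le> k)}" for i
  obtain c where c: "infinite c" "\<And>i. i \<in> I \<Longrightarrow> \<exists>d\<in>D i. c \<subseteq>* d"
  proof (rule pseudo_intersection_dense[OF assms, of D])
    show "infinite d" if "d \<in> D i" for i d
      using that unfolding D_def by blast
    show "\<exists>d\<in>D i. d \<subseteq> a" if "infinite a" for i a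
      by (rule infinite_sparse_subset[OF that, of "f i"]) (auto simp: D_def)
  qed blast
  have "\<exists>m\<in>c. n < m" for n
    using c(1) infinite_nat_iff_unbounded by blast
  then obtain nxt where nxt: "\<And>n. nxt n \<in> c" "\<And>n. n < nxt n"
    by metis
  show thesis
  proof
    fix i assume "i \<in> I"
    then obtain d where d: "d \<in> D i" "finite (c - d)"
      using c(2) unfolding almost_subset_def by blast
    obtain N where N: "\<And>m. m \<in> c - d \<Longrightarrow> m < N"
      using d(2) unfolding finite_nat_set_iff_bounded by blast
    \<comment> \<open>Two jumps are needed because \<open>n\<close> itself may lie outside
      \<open>d\<close>: the first reaches some \<open>m > n\<close> in \<open>d\<close>, and the
      next element of \<open>d\<close> used here bounds \<open>f i\<close> on all arguments up to
      \<open>m\<close>.\<close>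
    show "\<exists>N. \<forall>n\<ge>N. f i n \<le> nxt (nxt n)"
    proof (intro exI allI impI)
      fix n assume "n \<ge> N"
      then have "nxt n \<in> d" "nxt (nxt n) \<in> d"
        using N[of "nxt n"] N[of "nxt (nxt n)"] nxt(1)[of n] nxt(1)[of "nxt n"]
          nxt(2)[of n] nxt(2)[of "nxt n"] by force+
      then show "f i n \<le> nxt (nxt n)"
        using d(1) nxt(2)[of n] nxt(2)[of "nxt n"] unfolding D_def by auto
    qed
  qed
qed

subsection \<open>Selecting \<open>\<gamma>\<close>-covers from \<open>\<tau>\<close>-covers\<close>

lemma tau_cover_gamma_sequence:
  assumes X: "X \<noteq> {}" "|X| <o tower_number"
    and U: "tau_cover X \<U>" "countable \<U>"
  obtains v :: "nat \<Rightarrow> 'a set" where "\<And>n. v n \<in> \<U>" "\<And>x. x \<in> X \<Longrightarrow> finite {n. x \<notin> v n}"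
proof -
  have large: "infinite {u \<in> \<U>. x \<in> u}" if "x \<in> X" for x
    using U(1) that unfolding tau_cover_def large_cover_def by blast
  then have "infinite \<U>"
    using X(1) by (metis (no_types, lifting) all_not_in_conv finite_subset mem_Collect_eq subsetI)
  then have bij: "bij_betw (from_nat_into \<U>) UNIV \<U>"
    using U(2) by (intro bij_betw_from_nat_into)
  define e where "e = from_nat_into \<U>"
  have e: "inj e" "range e = \<U>"
    using bij unfolding e_def bij_betw_def by auto
  \<comment> \<open>The injective enumeration \<open>e\<close> translates finiteness statements
    about members of the cover into statements about indices.\<close>
  have fin: "finite {n. P (e n)} \<longleftrightarrow> finite {u \<in> \<U>. P u}" for P
  proof -
    have "e ` {n. P (e n)} = {u \<in> \<U>. P u}"
      using e(2) by blast
    then show ?thesis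
      using finite_image_iff[OF inj_on_subset[OF e(1) subset_UNIV]] by metis
  qed
  obtain c where c: "infinite c" "\<And>x. x \<in> X \<Longrightarrow> c \<subseteq>* {n. x \<in> e n}"
  proof (rule pseudo_intersection_exists[OF X(2), of "\<lambda>x. {n. x \<in> e n}"])
    show "infinite {n. x \<in> e n}" if "x \<in> X" for x
      using fin[of "\<lambda>u. x \<in> u"] large[OF that] by blast
    show "{n. x \<in> e n} \<subseteq>* {n. y \<in> e n} \<or> {n. y \<in> e n} \<subseteq>* {n. x \<in> e n}"
      if "x \<in> X" "y \<in> X" for x y
    proof -
      have "finite {u \<in> \<U>. \<not> (x \<in> u \<longrightarrow> y \<in> u)} \<or> finite {u \<in> \<U>. \<not> (y \<in> u \<longrightarrow> x \<in> u)}"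
        using U(1) that unfolding tau_cover_def by blast
      then have "finite {n. \<not> (x \<in> e n \<longrightarrow> y \<in> e n)} \<or> finite {n. \<not> (y \<in> e n \<longrightarrow> x \<in> e n)}"
        using fin[of "\<lambda>u. \<not> (x \<in> u \<longrightarrow> y \<in> u)"] fin[of "\<lambda>u. \<not> (y \<in> u \<longrightarrow> x \<in> u)"] by blast
      then show ?thesis
        unfolding almost_subset_def by (simp add: set_diff_eq)
    qed
  qed blast
  show thesis
  proof
    show "e (enumerate c n) \<in> \<U>" for n
      using e(2) by blast
    \<comment> \<open>The enumeration of \<open>c\<close> maps these indices injectively into
      \<open>c - {n. x \<in> e n}\<close>, which is finite.\<close>
    show "finite {n. x \<notin> e (enumerate c n)}" if "x \<in> X" for x
    proof (rule finite_imageD)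
      show "inj_on (enumerate c) {n. x \<notin> e (enumerate c n)}"
        using c(1) by (intro strict_mono_imp_inj_on[THEN inj_on_subset] strict_mono_enumerate) auto
      show "finite (enumerate c ` {n. x \<notin> e (enumerate c n)})"
        using c(2)[OF that] unfolding almost_subset_def
        by (rule rev_finite_subset) (auto simp: enumerate_in_set c(1))
    qed
  qed
qed

lemma gamma_cover_range:
  fixes U :: "nat \<Rightarrow> 'a set"
  assumes "\<And>n. U n \<subseteq> X" "\<And>n. U n \<noteq> X" and fin: "\<And>x. x \<in> X \<Longrightarrow> finite {n. x \<notin> U n}"
  shows "gamma_cover X (range U)"
proof -
  have inX: "\<exists>n\<in>S. x \<in> U n" if "x \<in> X" "infinite S" for x S
    using that fin[of x] finite_subset[of S "{n. x \<notin> U n}"] by blast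
  have "infinite (range U)"
  proof
    \<comment> \<open>A set chosen infinitely often would contain every point of \<open>X\<close>.\<close>
    assume "finite (range U)"
    then obtain n where n: "infinite {m. U m = U n}"
      using pigeonhole_infinite[of UNIV U] by auto
    have "X \<subseteq> U n"
      using inX[OF _ n] by blast
    then show False using assms by blast
  qed
  moreover have "finite {u \<in> range U. x \<notin> u}" if "x \<in> X" for x
    by (rule finite_subset[OF _ finite_imageI[OF fin[OF that], of U]]) auto
  moreover have "\<Union>(range U) = X"
    using assms(1) inX[of _ UNIV] by blast
  ultimately show ?thesis
    using assms(2) unfolding gamma_cover_def is_cover_def by blast
qed

lemma gamma_selection_below_tower_number:
  fixes X :: "'a set" and \<U> :: "nat \<Rightarrow> 'a set set"
  assumes X: "X \<noteq> {}" "|X| <o tower_number"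
    and U: "\<And>n. tau_cover X (\<U> n)" "\<And>n. countable (\<U> n)"
  obtains U where "\<And>n. U n \<in> \<U> n" "gamma_cover X (range U)"
proof -
  have "\<exists>v :: nat \<Rightarrow> 'a set. (\<forall>k. v k \<in> \<U> n) \<and> (\<forall>x\<in>X. finite {k. x \<notin> v k})" for n
  proof -
    obtain v :: "nat \<Rightarrow> 'a set" where "\<And>k. v k \<in> \<U> n" "\<And>x. x \<in> X \<Longrightarrow> finite {k. x \<notin> v k}"
      using tau_cover_gamma_sequence[OF X U(1)[of n] U(2)[of n]] by blast
    then show ?thesis by (intro exI[of _ v]) simp
  qed
  then have "\<exists>v :: nat \<Rightarrow> nat \<Rightarrow> 'a set. \<forall>n. (\<forall>k. v n k \<in> \<U> n) \<and> (\<forall>x\<in>X. finite {k. x \<notin> v n k})"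
    by (intro choice allI)
  then obtain v :: "nat \<Rightarrow> nat \<Rightarrow> 'a set" where v: "\<And>n k. v n k \<in> \<U> n" "\<And>n x. x \<in> X \<Longrightarrow> finite {k. x \<notin> v n k}"
    by blast
  have "\<exists>N. \<forall>k\<ge>N. x \<in> v n k" if "x \<in> X" for x n
    using v(2)[OF that, of n] unfolding finite_nat_set_iff_bounded
    by (meson linorder_not_less mem_Collect_eq)
  \<comment> \<open>\<open>f x n\<close> is a stage from which \<open>x\<close> stays in the
    \<open>n\<close>-th sequence. If \<open>g\<close> eventually dominates \<open>f x\<close>, then
    \<open>x\<close> lies in \<open>v n (g n)\<close> for almost all \<open>n\<close>.\<close>
  then have "\<forall>x\<in>X. \<exists>f. \<forall>n. \<forall>k\<ge>f n. x \<in> v n k"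
    by (intro ballI choice allI)
  then obtain f where f: "\<And>x n k. x \<in> X \<Longrightarrow> k \<ge> f x n \<Longrightarrow> x \<in> v n k"
    unfolding bchoice_iff by blast
  obtain g where g: "\<And>x. x \<in> X \<Longrightarrow> \<exists>N. \<forall>n\<ge>N. f x n \<le> g n"
    using eventually_bounded_below_tower_number[OF X(2), of f] by blast
  show thesis
  proof
    show mem: "v n (g n) \<in> \<U> n" for n
      using v(1) .
    show "gamma_cover X (range (\<lambda>n. v n (g n)))"
    proof (rule gamma_cover_range)
      show "v n (g n) \<subseteq> X" "v n (g n) \<noteq> X" for n
        using U(1)[of n] mem[of n] unfolding tau_cover_def large_cover_def is_cover_def by auto
      fix x assume x: "x \<in> X"
      then obtain N where "\<forall>n\<ge>N. f x n \<le> g n"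
        using g by blast
      then have "{n. x \<notin> v n (g n)} \<subseteq> {..<N}"
        using f[OF x] by (metis (no_types, lifting) lessThan_iff mem_Collect_eq not_le subsetI)
      then show "finite {n. x \<notin> v n (g n)}"
        using finite_subset by blast
    qed
  qed
qed

lemma S1_borel_below_tower_number:
  assumes "X \<noteq> {}" "|X| <o tower_number"
  shows "X \<in> S1 borel_tau_covers borel_gamma_covers"
  unfolding S1_def
proof (intro CollectI allI impI)
  fix \<U> :: "nat \<Rightarrow> real set set"
  assume U: "\<forall>n. \<U> n \<in> borel_tau_covers X"
  then obtain U where "\<And>n. U n \<in> \<U> n" "gamma_cover X (range U)"
    using gamma_selection_below_tower_number[OF assms, of \<U>] unfolding borel_tau_covers_def by auto
  with U show "\<exists>U. (\<forall>n. U n \<in> \<U> n) \<and> range U \<in> borel_gamma_covers X"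
    unfolding borel_tau_covers_def borel_gamma_covers_def by (intro exI[of _ U]) auto
qed

lemma openin_imp_borel_restrict:
  assumes "openin (top_of_set X) U"
  shows "U \<in> sets (restrict_space borel X)"
proof -
  obtain V where "open V" "U = X \<inter> V"
    using assms unfolding openin_open by blast
  then show ?thesis
    unfolding sets_restrict_space by (intro image_eqI[of _ _ V]) simp_all
qed

text \<open>Open \<tau>-covers are Borel \<tau>-covers, and the selected sets are open again because
  they are members of the given covers.\<close>

lemma S1_borel_subset_S1_open:
  "S1 borel_tau_covers borel_gamma_covers \<subseteq> S1 open_tau_covers open_gamma_covers"
proof
  fix X assume X: "X \<in> S1 borel_tau_covers borel_gamma_covers"
  show "X \<in> S1 open_tau_covers open_gamma_covers"
    unfolding S1_def
  proof (intro CollectI allI impI)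
    fix \<U> :: "nat \<Rightarrow> real set set"
    assume U: "\<forall>n. \<U> n \<in> open_tau_covers X"
    then have "\<forall>n. \<U> n \<in> borel_tau_covers X"
      unfolding open_tau_covers_def borel_tau_covers_def by (simp add: openin_imp_borel_restrict)
    then obtain U where "\<And>n. U n \<in> \<U> n" "range U \<in> borel_gamma_covers X"
      using X unfolding S1_def by blast
    with U show "\<exists>U. (\<forall>n. U n \<in> \<U> n) \<and> range U \<in> open_gamma_covers X"
      unfolding open_tau_covers_def open_gamma_covers_def borel_gamma_covers_def
      by (intro exI[of _ U]) auto
  qed
qed

subsection \<open>A tower as a set of reals\<close>

text \<open>Base 4 with digits 0 and 1 leaves gaps: all digits after position \<open>m\<close>
  together contribute at most a third of \<open>(1/4) ^ m\<close>, so distinct sets get distinct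
  codes.\<close>

definition cantor_code :: "nat set \<Rightarrow> real" where
  "cantor_code a = (\<Sum>n. of_bool (n \<in> a) * (1/4) ^ n)"

text \<open>Position \<open>m\<close> contributes \<open>(1/4) ^ m\<close>, and in the worst case
  the later positions take back a third of it.\<close>

lemma cantor_code_diff_ge:
  assumes agree: "\<And>k. k < m \<Longrightarrow> k \<in> a \<longleftrightarrow> k \<in> b" and "m \<in> a" "m \<notin> b"
  shows "cantor_code a - cantor_code b \<ge> 2/3 * (1/4) ^ m"
proof -
  define t where "t n = (of_bool (n \<in> a) - of_bool (n \<in> b)) * (1/4::real) ^ n" for n
  have geo: "summable (\<lambda>n. (1/4::real) ^ n)"
    by (intro summable_geometric) auto
  have summ: "summable (\<lambda>n. of_bool (n \<in> c) * (1/4::real) ^ n)" for c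
    by (rule summable_comparison_test[OF _ geo]) auto
  have t: "summable t" "suminf t = cantor_code a - cantor_code b"
    using summable_diff[OF summ summ] suminf_diff[OF summ summ]
    unfolding t_def cantor_code_def by (auto simp: left_diff_distrib)
  have tail: "(\<lambda>n. - ((1/4::real) ^ Suc m * (1/4) ^ n)) sums - ((1/4) ^ Suc m * (4/3))"
    using geometric_sums[of "1/4::real"] by (intro sums_minus sums_mult) simp
  have "- ((1/4::real) ^ Suc m * (4/3)) \<le> (\<Sum>n. t (n + Suc m))"
  proof (rule sums_le[OF _ tail])
    show "- ((1/4) ^ Suc m * (1/4) ^ n) \<le> t (n + Suc m)" for n
      by (auto simp: t_def power_add)
    show "(\<lambda>n. t (n + Suc m)) sums (\<Sum>n. t (n + Suc m))"
      using t(1) by (intro summable_sums) (simp only: summable_iff_shift)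
  qed
  moreover have "sum t {..<Suc m} = (1/4) ^ m"
    using assms by (simp add: t_def)
  ultimately show ?thesis
    using suminf_split_initial_segment[OF t(1), of "Suc m"] t(2) by simp
qed

text \<open>The first position \<open>m\<close> where the sets differ forces a gap of
  \<open>2/3 * (1/4) ^ m\<close>; if they differ at \<open>n\<close>, then \<open>m \<le> n\<close>
  and the gap is too large. Injectivity and openness of the cover members both follow from
  this.\<close>

lemma cantor_code_close:
  assumes "\<bar>cantor_code a - cantor_code b\<bar> < 2/3 * (1/4) ^ n"
  shows "n \<in> a \<longleftrightarrow> n \<in> b"
proof (rule ccontr)
  define m where "m = (LEAST k. (k \<in> a) \<noteq> (k \<in> b))"
  assume n: "(n \<in> a) \<noteq> (n \<in> b)"
  then have m: "(m \<in> a) \<noteq> (m \<in> b)" "m \<le> n"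
    unfolding m_def by (rule LeastI, rule Least_le)
  have agree: "k \<in> a \<longleftrightarrow> k \<in> b" if "k < m" for k
    using not_less_Least[of k] that unfolding m_def by blast
  have "\<bar>cantor_code a - cantor_code b\<bar> \<ge> 2/3 * (1/4) ^ m"
  proof (cases "m \<in> a")
    case True
    then have "2/3 * (1/4) ^ m \<le> cantor_code a - cantor_code b"
      using agree m(1) by (intro cantor_code_diff_ge) auto
    then show ?thesis by linarith
  next
    case False
    then have "2/3 * (1/4) ^ m \<le> cantor_code b - cantor_code a"
      using agree m(1) by (intro cantor_code_diff_ge) auto
    then show ?thesis by linarith
  qed
  moreover have "(1/4::real) ^ n \<le> (1/4) ^ m"
    using m(2) by (intro power_decreasing) auto
  ultimately show False using assms by simp
qed

lemma inj_cantor_code: "inj cantor_code"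
proof (rule injI)
  fix a b assume "cantor_code a = cantor_code b"
  then have "n \<in> a \<longleftrightarrow> n \<in> b" for n
    by (intro cantor_code_close) simp
  then show "a = b" by blast
qed

lemma openin_cantor_code_image:
  "openin (top_of_set (cantor_code ` S)) (cantor_code ` {a \<in> S. n \<in> a})"
  unfolding openin_euclidean_subtopology_iff
proof (intro conjI ballI)
  fix x assume "x \<in> cantor_code ` {a \<in> S. n \<in> a}"
  then obtain a where "x = cantor_code a" "n \<in> a"
    by blast
  then show "\<exists>e>0. \<forall>x'\<in>cantor_code ` S. dist x' x < e \<longrightarrow> x' \<in> cantor_code ` {a \<in> S. n \<in> a}"
  proof (intro exI[of _ "2/3 * (1/4) ^ n"] conjI ballI impI)
    fix x' assume "x' \<in> cantor_code ` S" "dist x' x < 2/3 * (1/4) ^ n"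
    then obtain b where "b \<in> S" "x' = cantor_code b" "\<bar>cantor_code b - cantor_code a\<bar> < 2/3 * (1/4) ^ n"
      using \<open>x = cantor_code a\<close> unfolding dist_real_def by blast
    then show "x' \<in> cantor_code ` {a \<in> S. n \<in> a}"
      using cantor_code_close[of b a n] \<open>n \<in> a\<close> by blast
  qed simp
qed blast

section \<open>From a tower to a space where the selection fails\<close>

lemma tower_infinite:
  assumes "tower T"
  shows "infinite T"
proof
  assume fin: "finite T"
  \<comment> \<open>A finite nonempty part of a linear quasiorder has a least element. The witness
    must belong to \<open>S\<close> to be comparable with the next set; the disjunct
    \<open>S = {}\<close> serves the base case.\<close>
  have "S \<subseteq> T \<Longrightarrow> \<exists>a. infinite a \<and> (a \<in> S \<or> S = {}) \<and> (\<forall>b\<in>S. a \<subseteq>* b)" if "finite S" for S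
    using that
  proof (induction S)
    case empty
    show ?case using infinite_UNIV_nat by blast
  next
    case (insert s S)
    then obtain a where a: "infinite a" "a \<in> S \<or> S = {}" "\<forall>b\<in>S. a \<subseteq>* b"
      by blast
    have s: "s \<subseteq>* s" "infinite s"
      using insert.prems assms subset_imp_almost_subset unfolding tower_def by auto
    show ?case
    proof (cases "S \<noteq> {} \<and> a \<subseteq>* s")
      case True
      then show ?thesis using a by blast
    next
      case False
      then have "S = {} \<or> s \<subseteq>* a"
        using a(2) insert.prems assms unfolding tower_def by blast
      then show ?thesis
        using s a(3) almost_subset_trans[of s a] by blast
    qed
  qed
  from this[OF fin subset_refl] show False
    using assms unfolding tower_def by blast
qed

text \<open>
  The sets \<open>-{n}\<close> separate the members \<open>{a. n \<in> a}\<close> of the cover from each other and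
  from the whole space.
\<close>

lemma tower_union_cofinite:
  assumes "tower T"
  shows "tower (T \<union> range (\<lambda>n. - {n}))"
proof -
  have *: "b \<subseteq>* - {n}" for b n
    unfolding almost_subset_def by (rule finite_subset[of _ "{n}"]) auto
  have "infinite (- {n::nat})" for n
    by (simp add: finite_compl)
  then show ?thesis
    using assms * unfolding tower_def by blast
qed

lemma tower_image_not_S1:
  assumes "tower S" and sep: "range (\<lambda>n. - {n}) \<subseteq> S"
  shows "cantor_code ` S \<notin> S1 open_tau_covers open_gamma_covers"
proof
  define X where "X = cantor_code ` S"
  define O' where "O' n = cantor_code ` {a \<in> S. n \<in> a}" for n :: nat
  assume "cantor_code ` S \<in> S1 open_tau_covers open_gamma_covers"
  then have S1: "X \<in> S1 open_tau_covers open_gamma_covers"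
    unfolding X_def .
  have O'_iff: "cantor_code a \<in> O' n \<longleftrightarrow> n \<in> a" if "a \<in> S" for a n
    using that inj_cantor_code unfolding O'_def by (auto dest: injD)
  have inf: "infinite a" if "a \<in> S" for a
    using assms(1) that unfolding tower_def by blast
  have injO: "inj O'"
  proof (rule injI)
    fix m n assume "O' m = O' n"
    moreover have "- {n} \<in> S" using sep by blast
    ultimately show "m = n"
      using O'_iff[of "- {n}" m] O'_iff[of "- {n}" n] by auto
  qed
  have fin: "finite {U \<in> range O'. P U} \<longleftrightarrow> finite {n. P (O' n)}" for P
  proof -
    have "{U \<in> range O'. P U} = O' ` {n. P (O' n)}" by blast
    then show ?thesis
      using finite_image_iff[OF inj_on_subset[OF injO subset_UNIV]] by metis
  qed
  have "X \<notin> range O'"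
  proof
    assume "X \<in> range O'"
    then obtain n where "X = O' n" by blast
    moreover have "- {n} \<in> S" using sep by blast
    ultimately show False
      using O'_iff[of "- {n}" n] unfolding X_def by auto
  qed
  moreover have "\<Union>(range O') = X"
  proof
    show "\<Union>(range O') \<subseteq> X"
      unfolding O'_def X_def by blast
    show "X \<subseteq> \<Union>(range O')"
    proof
      fix x assume "x \<in> X"
      then obtain a where a: "a \<in> S" "x = cantor_code a"
        unfolding X_def by blast
      then obtain n where "n \<in> a"
        using inf by (metis all_not_in_conv finite.emptyI)
      then show "x \<in> \<Union>(range O')"
        using O'_iff a by blast
    qed
  qed
  moreover have "infinite {U \<in> range O'. x \<in> U}" if x: "x \<in> X" for x
  proof -
    obtain a where a: "a \<in> S" "x = cantor_code a"
      using x unfolding X_def by blast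
    then show ?thesis
      unfolding fin using inf O'_iff[OF a(1)] by simp
  qed
  moreover have "finite {U \<in> range O'. \<not> (x \<in> U \<longrightarrow> y \<in> U)} \<or>
      finite {U \<in> range O'. \<not> (y \<in> U \<longrightarrow> x \<in> U)}" if xy: "x \<in> X" "y \<in> X" for x y
  proof -
    obtain a b where ab: "a \<in> S" "x = cantor_code a" "b \<in> S" "y = cantor_code b"
      using xy unfolding X_def by blast
    then have "a \<subseteq>* b \<or> b \<subseteq>* a"
      using assms(1) unfolding tower_def by blast
    then show ?thesis
      unfolding fin almost_subset_def using ab O'_iff by (simp add: set_diff_eq)
  qed
  ultimately have "range O' \<in> open_tau_covers X"
    using openin_cantor_code_image[of S]
    unfolding open_tau_covers_def tau_cover_def large_cover_def is_cover_def X_def O'_def by auto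
  \<comment> \<open>Already the constant sequence of covers defeats the selection principle.\<close>
  then obtain U where U: "\<And>n::nat. U n \<in> range O'" "range U \<in> open_gamma_covers X"
    using S1 unfolding S1_def by (auto dest!: spec[of _ "\<lambda>_::nat. range O'"])
  define c where "c = {n. O' n \<in> range U}"
  have gam: "infinite (range U)" "\<And>x. x \<in> X \<Longrightarrow> finite {u \<in> range U. x \<notin> u}"
    using U(2) unfolding open_gamma_covers_def gamma_cover_def by auto
  have "range U \<subseteq> O' ` c"
    using U(1) unfolding c_def by blast
  then have "infinite c"
    using gam(1) finite_surj by blast
  moreover have "c \<subseteq>* b" if b: "b \<in> S" for b
  proof -
    \<comment> \<open>Each index in \<open>c - b\<close> gives a selected member missing the point
      coded by \<open>b\<close>. There are finitely many such members, and \<open>O'\<close> is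
      injective.\<close>
    have "O' ` (c - b) \<subseteq> {u \<in> range U. cantor_code b \<notin> u}"
      using O'_iff[OF b] unfolding c_def by auto
    moreover have "finite {u \<in> range U. cantor_code b \<notin> u}"
      using gam(2) b unfolding X_def by blast
    ultimately show ?thesis
      unfolding almost_subset_def
      by (meson finite_imageD finite_subset injO inj_on_subset subset_UNIV)
  qed
  ultimately show False
    using assms(1) unfolding tower_def by blast
qed

text \<open>Since a tower is infinite, adjoining countably many sets does not raise its
  cardinality.\<close>

lemma tower_yields_not_S1:
  assumes "tower T"
  obtains X where "infinite X" "X \<notin> S1 open_tau_covers open_gamma_covers" "|X| \<le>o |T|"
proof
  let ?S = "T \<union> range (\<lambda>n. - {n})"
  have S: "tower ?S"
    using assms by (rule tower_union_cofinite)
  show "infinite (cantor_code ` ?S)"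
    using tower_infinite[OF S] finite_imageD inj_on_subset[OF inj_cantor_code subset_UNIV] by blast
  show "cantor_code ` ?S \<notin> S1 open_tau_covers open_gamma_covers"
    by (rule tower_image_not_S1[OF S Un_upper2])
  have T: "infinite T"
    using assms by (rule tower_infinite)
  have "|range (\<lambda>n. - {n::nat})| \<le>o |UNIV :: nat set|"
    by (rule card_of_image)
  also have "|UNIV :: nat set| \<le>o |T|"
    using T infinite_iff_card_of_nat by blast
  finally have cofin: "|range (\<lambda>n. - {n::nat})| \<le>o |T|" .
  have "infinite (Field |T| )"
    using T by (simp add: Field_card_of)
  then have "|?S| \<le>o |T|"
    by (rule card_of_Un_ordLeq_infinite_Field[OF _ card_of_mono1[OF subset_refl] cofin card_of_Card_order])
  then show "|cantor_code ` ?S| \<le>o |T|"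
    by (rule ordLeq_transitive[OF card_of_image])
qed

theorem theorem4p2:
  shows "non (S1 borel_tau_covers borel_gamma_covers) =o non (S1 open_tau_covers open_gamma_covers)
    \<and> non (S1 open_tau_covers open_gamma_covers) =o tower_number"
proof -
  let ?B = "S1 borel_tau_covers borel_gamma_covers"
  let ?O = "S1 open_tau_covers open_gamma_covers"
  obtain T where T: "tower T" "tower_number = |T|"
    using tower_number_attained by metis
  obtain X where X: "infinite X" "X \<notin> ?O" "|X| \<le>o |T|"
    using tower_yields_not_S1[OF T(1)] by blast
  obtain A where A: "infinite A" "A \<notin> ?O" "non ?O = |A|"
      "\<And>Y. infinite Y \<Longrightarrow> Y \<notin> ?O \<Longrightarrow> |A| \<le>o |Y|"
    using min_card_attained[of "{X. infinite X \<and> X \<notin> ?O}"] X unfolding non_def by blast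
  obtain B where B: "infinite B" "B \<notin> ?B" "non ?B = |B|"
      "\<And>Y. infinite Y \<Longrightarrow> Y \<notin> ?B \<Longrightarrow> |B| \<le>o |Y|"
    using min_card_attained[of "{X. infinite X \<and> X \<notin> ?B}"] A(1,2) S1_borel_subset_S1_open
    unfolding non_def by blast
  \<comment> \<open>The cycle \<open>B\<close>, \<open>A\<close>, \<open>T\<close>, \<open>B\<close>
    of inequalities starts here: a space outside the open class is outside the Borel class
    too.\<close>
  have BA: "|B| \<le>o |A|"
    using A(1,2) B(4) S1_borel_subset_S1_open by blast
  have AT: "|A| \<le>o |T|"
    using A(4)[OF X(1,2)] X(3) ordLeq_transitive by blast
  have "\<not> |B| <o |T|"
    using S1_borel_below_tower_number[of B] B(1,2) T(2) by auto
  then have TB: "|T| \<le>o |B|"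
    by (rule not_ordLess_iff_ordLeq[OF card_of_Well_order card_of_Well_order, THEN iffD1])
  have "|B| =o |A|" "|A| =o |T|"
    using BA AT TB ordLeq_transitive[OF AT TB] ordLeq_transitive[OF TB BA]
    by (simp_all add: ordIso_iff_ordLeq)
  then show ?thesis
    using A(3) B(3) T(2) by simp
qed

end
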